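(* Let $H=H_0+V$ where $V$ is $(\Gamma,\mathcal M)$ pseudo-ergodic, and let $K=H_0+W$ where $W:X\to\mathcal M$ is arbitrary. Then $\sigma_{\rm loc}(K)\subseteq\sigma_{\rm loc}(H)$. Thus every eigenvalue of $K$ lies in the localized spectrum $\sigma_{\rm loc}(H)$ of $H$. Moreover, if $V$ and $W$ are both $(\Gamma,\mathcal M)$ pseudo-ergodic then $H$ and $K$ have the same localized spectrum, i.e. $\sigma_{\rm loc}(H)=\sigma_{\rm loc}(K)$.
   Context: $X$ is a countable set with a metric $d$ such that every ball $\{y\in X:d(x,y)\le r\}$ is finite, and $\Gamma$ is a group acting on $X$ by isometries. $\mathcal K$ is a Hilbert space, and operators act on $l^2(X,\mathcal K)\cong l^2(X)\otimes\mathcal K$. For $\gamma\in\Gamma$ the unitary $U_\gamma$ is $(U_\gamma f)(x)=f(\gamma^{-1}x)$. $H_0$ is a bounded operator on $l^2(X)$ with $H_0U_\gamma=U_\gamma H_0$ for all $\gamma\in\Gamma$; the operator $H_0\otimes I$ on $l^2(X,\mathcal K)$ is also written $H_0$. $\mathcal M\subseteq\mathcal L(\mathcal K)$ (bounded operators on $\mathcal K$) is a norm closed, bounded set. A function $V:X\to\mathcal M$ is identified with the bounded operator $(Vf)(x)=V(x)f(x)$. A potential $V:X\to\mathcal M$ is $(\Gamma,\mathcal M)$ pseudo-ergodic if for every $\varepsilon>0$, every finite $F\subset X$ and every $W:F\to\mathcal M$ there exists $\gamma\in\Gamma$ such that $\|W(x)-V(\gamma x)\|<\varepsilon$ for all $x\in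 F$. For $f:X\to\mathcal K$ with $\|f\|_2=1$ the variance is $\mathrm{var}(f)=\min_{y\in X}\sum_{x\in X}d(x,y)^2\|f(x)\|^2$. The localized spectrum $\sigma_{\rm loc}(A)$ of a bounded operator $A$ on $l^2(X,\mathcal K)$ is the set of all $\lambda\in\mathbf C$ for which there exists a sequence of unit vectors $f_n\in l^2(X,\mathcal K)$ such that $\|Af_n-\lambda f_n\|\to0$ while $\mathrm{var}(f_n)$ remains uniformly bounded.
   Formalization: The claim that every eigenvalue of K lies in the localized spectrum of H is stated only for eigenvalues having an eigenvector of finite variance; for eigenvectors of infinite variance it can fail (e.g. H_0 a rank-one projection onto such a vector, Γ trivial, V = W = 0). *)

theory Defs
  imports "HOL-Analysis.Analysis" "HOL-Algebra.Group_Action"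
begin

section \<open>Complex Hilbert spaces\<close>

class complex_normed_space = real_normed_vector +
  fixes scaleC :: "complex \<Rightarrow> 'a \<Rightarrow> 'a"  (infixr "*\<^sub>C" 75)
  assumes scaleC_add_right: "c *\<^sub>C (x + y) = c *\<^sub>C x + c *\<^sub>C y"
    and scaleC_add_left: "(b + c) *\<^sub>C x = b *\<^sub>C x + c *\<^sub>C x"
    and scaleC_scaleC: "b *\<^sub>C (c *\<^sub>C x) = (b * c) *\<^sub>C x"
    and scaleC_of_real: "complex_of_real r *\<^sub>C x = r *\<^sub>R x"
    and norm_scaleC: "norm (c *\<^sub>C x) = cmod c * norm x"

class complex_hilbert_space = complex_normed_space + complete_space +
  fixes cinner :: "'a \<Rightarrow> 'a \<Rightarrow> complex"
  assumes cinner_commute: "cinner x y = cnj (cinner y x)"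
    and cinner_add_right: "cinner x (y + z) = cinner x y + cinner x z"
    and cinner_scaleC_right: "cinner x (c *\<^sub>C y) = c * cinner x y"
    and norm_eq_sqrt_cinner: "norm x = sqrt (Re (cinner x x))"

instantiation complex :: complex_hilbert_space
begin

definition scaleC_complex :: "complex \<Rightarrow> complex \<Rightarrow> complex"
  where "scaleC_complex c x = c * x"

definition cinner_complex :: "complex \<Rightarrow> complex \<Rightarrow> complex"
  where "cinner_complex x y = cnj x * y"

instance
proof
  fix b c x y z :: complex and r :: real
  show "norm x = sqrt (Re (cinner x x))"
    by (simp add: cinner_complex_def cmod_def power2_eq_square)
qed (simp_all add: scaleC_complex_def cinner_complex_def algebra_simps norm_mult scaleR_conv_of_real)

end

definition bounded_clinear :: "('a::complex_normed_space \<Rightarrow> 'b::complex_normed_space) \<Rightarrow> bool"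
  where "bounded_clinear A \<longleftrightarrow> bounded_linear A \<and> (\<forall>c x. A (c *\<^sub>C x) = c *\<^sub>C A x)"


section \<open>The space \<open>l\<^sup>2(X, K)\<close>\<close>

typedef (overloaded) ('x, 'k::real_normed_vector) l2 =
  "{f :: 'x \<Rightarrow> 'k. (\<lambda>x. (norm (f x))\<^sup>2) summable_on UNIV}"
  morphisms l2_apply Abs_l2
  by (rule exI[of _ "\<lambda>_. 0"]) simp

setup_lifting type_definition_l2

lemma l2_minkowski:
  fixes f g :: "'x \<Rightarrow> 'k::real_normed_vector"
  assumes f: "(\<lambda>x. (norm (f x))\<^sup>2) summable_on UNIV"
    and g: "(\<lambda>x. (norm (g x))\<^sup>2) summable_on UNIV"
  shows "(\<lambda>x. (norm (f x + g x))\<^sup>2) summable_on UNIV" (is ?A)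
    and "sqrt (\<Sum>\<^sub>\<infinity>x. (norm (f x + g x))\<^sup>2)
           \<le> sqrt (\<Sum>\<^sub>\<infinity>x. (norm (f x))\<^sup>2) + sqrt (\<Sum>\<^sub>\<infinity>x. (norm (g x))\<^sup>2)" (is ?B)
proof -
  let ?s = "\<lambda>h. sqrt (\<Sum>\<^sub>\<infinity>x::'x. (norm (h x :: 'k))\<^sup>2)"
  have nn: "0 \<le> ?s h" for h
    by (simp add: infsum_nonneg)
  have L2: "L2_set (\<lambda>x. norm (h x)) F \<le> ?s h"
    if "(\<lambda>x. (norm (h x))\<^sup>2) summable_on UNIV" "finite F" for h :: "'x \<Rightarrow> 'k" and F
    unfolding L2_set_def
    by (rule real_sqrt_le_mono, rule finite_sum_le_infsum[OF that(1)]) (use that in auto)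
  have fin: "(\<Sum>x\<in>F. (norm (f x + g x))\<^sup>2) \<le> (?s f + ?s g)\<^sup>2" if F: "finite F" for F
  proof -
    have "L2_set (\<lambda>x. norm (f x + g x)) F \<le> L2_set (\<lambda>x. norm (f x) + norm (g x)) F"
      by (rule L2_set_mono) (auto intro: norm_triangle_ineq)
    also have "\<dots> \<le> L2_set (\<lambda>x. norm (f x)) F + L2_set (\<lambda>x. norm (g x)) F"
      by (rule L2_set_triangle_ineq)
    also have "\<dots> \<le> ?s f + ?s g"
      by (rule add_mono[OF L2[OF f F] L2[OF g F]])
    finally have "(L2_set (\<lambda>x. norm (f x + g x)) F)\<^sup>2 \<le> (?s f + ?s g)\<^sup>2"
      by (rule power_mono) simp
    then show ?thesis
      by (simp add: L2_set_def sum_nonneg)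
  qed
  show A: ?A
    by (rule nonneg_bdd_above_summable_on) (auto intro!: bdd_aboveI2[of _ _ "(?s f + ?s g)\<^sup>2"] fin)
  have "(\<Sum>\<^sub>\<infinity>x. (norm (f x + g x))\<^sup>2) \<le> (?s f + ?s g)\<^sup>2"
    by (rule infsum_le_finite_sums[OF A]) (rule fin)
  then show ?B
    using nn[of f] nn[of g] by (simp add: real_le_lsqrt)
qed

instantiation l2 :: (type, complex_normed_space) complex_normed_space
begin

lift_definition zero_l2 :: "('a, 'b) l2" is "\<lambda>_. 0"
  by simp

lift_definition plus_l2 :: "('a, 'b) l2 \<Rightarrow> ('a, 'b) l2 \<Rightarrow> ('a, 'b) l2" is "\<lambda>f g x. f x + g x"
  by (simp add: l2_minkowski)

lift_definition uminus_l2 :: "('a, 'b) l2 \<Rightarrow> ('a, 'b) l2" is "\<lambda>f x. - f x"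
  by simp

lift_definition minus_l2 :: "('a, 'b) l2 \<Rightarrow> ('a, 'b) l2 \<Rightarrow> ('a, 'b) l2" is "\<lambda>f g x. f x - g x"
proof -
  fix f g :: "'a \<Rightarrow> 'b"
  assume "(\<lambda>x. (norm (f x))\<^sup>2) summable_on UNIV" "(\<lambda>x. (norm (g x))\<^sup>2) summable_on UNIV"
  then show "(\<lambda>x. (norm (f x - g x))\<^sup>2) summable_on UNIV"
    using l2_minkowski(1)[of f "\<lambda>x. - g x"] by simp
qed

lift_definition scaleR_l2 :: "real \<Rightarrow> ('a, 'b) l2 \<Rightarrow> ('a, 'b) l2" is "\<lambda>r f x. r *\<^sub>R f x"
  by (simp add: power_mult_distrib summable_on_cmult_right)

lift_definition scaleC_l2 :: "complex \<Rightarrow> ('a, 'b) l2 \<Rightarrow> ('a, 'b) l2" is "\<lambda>c f x. c *\<^sub>C f x"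
  by (simp add: norm_scaleC power_mult_distrib summable_on_cmult_right)

lift_definition norm_l2 :: "('a, 'b) l2 \<Rightarrow> real" is "\<lambda>f. sqrt (\<Sum>\<^sub>\<infinity>x. (norm (f x))\<^sup>2)" .

definition sgn_l2 :: "('a, 'b) l2 \<Rightarrow> ('a, 'b) l2"
  where "sgn_l2 f = inverse (norm f) *\<^sub>R f"

definition dist_l2 :: "('a, 'b) l2 \<Rightarrow> ('a, 'b) l2 \<Rightarrow> real"
  where "dist_l2 f g = norm (f - g)"

definition uniformity_l2 :: "(('a, 'b) l2 \<times> ('a, 'b) l2) filter"
  where "uniformity_l2 = (INF e\<in>{0<..}. principal {(f, g). dist f g < e})"

definition open_l2 :: "('a, 'b) l2 set \<Rightarrow> bool"
  where "open_l2 S \<longleftrightarrow> (\<forall>f\<in>S. eventually (\<lambda>(f', g). f' = f \<longrightarrow> g \<in> S) uniformity)"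

instance
proof
  fix f g h :: "('a, 'b) l2" and r s :: real and b c :: complex
  show "f + g + h = f + (g + h)" by transfer (simp add: add.assoc)
  show "f + g = g + f" by transfer (simp add: add.commute)
  show "0 + f = f" by transfer simp
  show "- f + f = 0" by transfer simp
  show "f - g = f + - g" by transfer simp
  show "r *\<^sub>R (f + g) = r *\<^sub>R f + r *\<^sub>R g" by transfer (simp add: scaleR_add_right)
  show "(r + s) *\<^sub>R f = r *\<^sub>R f + s *\<^sub>R f" by transfer (simp add: scaleR_add_left)
  show "r *\<^sub>R s *\<^sub>R f = (r * s) *\<^sub>R f" by transfer simp
  show "1 *\<^sub>R f = f" by transfer simp
  show "sgn f = inverse (norm f) *\<^sub>R f" by (rule sgn_l2_def)
  show "dist f g = norm (f - g)" by (rule dist_l2_def)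
  show "uniformity = (INF e\<in>{0<..}. principal {(f :: ('a, 'b) l2, g). dist f g < e})"
    by (rule uniformity_l2_def)
  show "open S \<longleftrightarrow> (\<forall>f\<in>S. \<forall>\<^sub>F (f', g) in uniformity. f' = f \<longrightarrow> g \<in> S)"
    for S :: "('a, 'b) l2 set"
    by (rule open_l2_def)
  show "norm f = 0 \<longleftrightarrow> f = 0"
  proof transfer
    fix f :: "'a \<Rightarrow> 'b"
    assume "(\<lambda>x. (norm (f x))\<^sup>2) summable_on UNIV"
    then show "sqrt (\<Sum>\<^sub>\<infinity>x. (norm (f x))\<^sup>2) = 0 \<longleftrightarrow> f = (\<lambda>_. 0)"
      using nonneg_infsum_le_0D[of "\<lambda>x. (norm (f x))\<^sup>2" UNIV] by (auto simp: fun_eq_iff)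
  qed
  show "norm (f + g) \<le> norm f + norm g" by transfer (rule l2_minkowski)
  show "norm (r *\<^sub>R f) = \<bar>r\<bar> * norm f"
    by transfer (simp add: power_mult_distrib infsum_cmult_right' real_sqrt_mult)
  show "c *\<^sub>C (f + g) = c *\<^sub>C f + c *\<^sub>C g" by transfer (simp add: scaleC_add_right)
  show "(b + c) *\<^sub>C f = b *\<^sub>C f + c *\<^sub>C f" by transfer (simp add: scaleC_add_left)
  show "b *\<^sub>C (c *\<^sub>C f) = (b * c) *\<^sub>C f" by transfer (simp add: scaleC_scaleC)
  show "complex_of_real r *\<^sub>C f = r *\<^sub>R f" by transfer (simp add: scaleC_of_real)
  show "norm (c *\<^sub>C f) = cmod c * norm f"
    by transfer (simp add: norm_scaleC power_mult_distrib infsum_cmult_right' real_sqrt_mult)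
qed

end


section \<open>Operators on \<open>l\<^sup>2(X, K)\<close>\<close>

lift_definition pure_tensor ::
  "('x, complex) l2 \<Rightarrow> 'k::complex_normed_space \<Rightarrow> ('x, 'k) l2"  (infixr "\<otimes>\<^sub>2" 70)
  is "\<lambda>\<phi> k x. \<phi> x *\<^sub>C k"
  by (simp add: norm_scaleC power_mult_distrib summable_on_cmult_left)

text \<open>The operator \<open>A \<otimes> I\<close>, for a bounded operator \<open>A\<close> on \<open>l\<^sup>2(X)\<close> and a Hilbert space \<open>K\<close>: the unique
  bounded operator on \<open>l\<^sup>2(X, K) \<cong> l\<^sup>2(X) \<otimes> K\<close> with \<open>(A \<otimes> I)(\<phi> \<otimes> k) = A \<phi> \<otimes> k\<close>. Uniqueness holds because
  the pure tensors span a dense subspace.\<close>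

definition tensor_id ::
  "(('x, complex) l2 \<Rightarrow> ('x, complex) l2) \<Rightarrow> ('x, 'k::complex_hilbert_space) l2 \<Rightarrow> ('x, 'k) l2"
  where "tensor_id A = (THE T. bounded_clinear T \<and> (\<forall>\<phi> k. T (\<phi> \<otimes>\<^sub>2 k) = A \<phi> \<otimes>\<^sub>2 k))"

text \<open>Multiplication by a potential. The value is only meaningful if the potential is bounded, as
  \<open>l2_apply_mult_op\<close> shows.\<close>

definition mult_op ::
  "('x \<Rightarrow> 'k \<Rightarrow>\<^sub>L 'k) \<Rightarrow> ('x, 'k::complex_hilbert_space) l2 \<Rightarrow> ('x, 'k) l2"
  where "mult_op V f = Abs_l2 (\<lambda>x. blinfun_apply (V x) (l2_apply f x))"

lemma l2_apply_mult_op: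
  fixes V :: "'x \<Rightarrow> 'k \<Rightarrow>\<^sub>L 'k::complex_hilbert_space"
  assumes "bounded (range V)"
  shows "l2_apply (mult_op V f) x = blinfun_apply (V x) (l2_apply f x)"
proof -
  obtain B where B: "norm (V x) \<le> B" for x
    using assms by (auto simp: bounded_iff)
  have le: "(norm (blinfun_apply (V x) (l2_apply f x)))\<^sup>2 \<le> B\<^sup>2 * (norm (l2_apply f x))\<^sup>2" for x
  proof -
    have "norm (blinfun_apply (V x) (l2_apply f x)) \<le> norm (V x) * norm (l2_apply f x)"
      by (rule norm_blinfun)
    also have "\<dots> \<le> B * norm (l2_apply f x)"
      by (rule mult_right_mono[OF B]) simp
    finally show ?thesis
      by (metis norm_ge_zero power_mono power_mult_distrib)
  qed
  have "(\<lambda>x. B\<^sup>2 * (norm (l2_apply f x))\<^sup>2) summable_on UNIV"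
    using l2_apply[of f] by (simp add: summable_on_cmult_right)
  then have "(\<lambda>x. (norm (blinfun_apply (V x) (l2_apply f x)))\<^sup>2) summable_on UNIV"
    by (rule summable_on_comparison_test) (auto simp: le)
  then show ?thesis
    by (simp add: mult_op_def Abs_l2_inverse)
qed

text \<open>The unitary \<open>U\<^sub>\<gamma>\<close>; \<open>\<phi>\<close> is the action of the group \<open>G\<close> on the whole type \<open>'x\<close>.\<close>

definition translate_op ::
  "('g, 'm) monoid_scheme \<Rightarrow> ('g \<Rightarrow> 'x \<Rightarrow> 'x) \<Rightarrow> 'g \<Rightarrow> ('x, 'k::real_normed_vector) l2 \<Rightarrow> ('x, 'k) l2"
  where "translate_op G \<phi> \<gamma> f = Abs_l2 (\<lambda>x. l2_apply f (\<phi> (inv\<^bsub>G\<^esub> \<gamma>) x))"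

lemma l2_apply_translate_op:
  fixes \<phi> :: "'g \<Rightarrow> 'x \<Rightarrow> 'x" and f :: "('x, 'k::real_normed_vector) l2"
  assumes "group_action G UNIV \<phi>" and "\<gamma> \<in> carrier G"
  shows "l2_apply (translate_op G \<phi> \<gamma> f) x = l2_apply f (\<phi> (inv\<^bsub>G\<^esub> \<gamma>) x)"
proof -
  interpret group_action G UNIV \<phi> by fact
  have "group G"
    using group_hom by (simp add: group_hom_def)
  then have "inv\<^bsub>G\<^esub> \<gamma> \<in> carrier G"
    using assms(2) by simp
  then have "bij (\<phi> (inv\<^bsub>G\<^esub> \<gamma>))"
    using bij_prop0 by (simp add: Bij_def)
  then have "(\<lambda>x. (norm (l2_apply f (\<phi> (inv\<^bsub>G\<^esub> \<gamma>) x)))\<^sup>2) summable_on UNIV"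
    using l2_apply[of f]
      summable_on_reindex_bij_betw[of "\<phi> (inv\<^bsub>G\<^esub> \<gamma>)" UNIV UNIV "\<lambda>x. (norm (l2_apply f x))\<^sup>2"]
    by simp
  then show ?thesis
    by (simp add: translate_op_def Abs_l2_inverse)
qed


section \<open>Pseudo-ergodic potentials\<close>

definition pseudo_ergodic ::
  "('g, 'm) monoid_scheme \<Rightarrow> ('g \<Rightarrow> 'x \<Rightarrow> 'x) \<Rightarrow> ('k \<Rightarrow>\<^sub>L 'k::complex_hilbert_space) set
    \<Rightarrow> ('x \<Rightarrow> 'k \<Rightarrow>\<^sub>L 'k) \<Rightarrow> bool"
  where "pseudo_ergodic G \<phi> M V \<longleftrightarrow> range V \<subseteq> M \<and>
    (\<forall>\<epsilon>>0. \<forall>F. finite F \<longrightarrow> (\<forall>W. W ` F \<subseteq> M \<longrightarrow>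
      (\<exists>\<gamma>\<in>carrier G. \<forall>x\<in>F. norm (W x - V (\<phi> \<gamma> x)) < \<epsilon>)))"


section \<open>Variance and localized spectrum\<close>

text \<open>The second moment about a point may be infinite, so the variance takes values in
  \<open>[0, \<infinity>]\<close>. If all balls are finite, the infimum is a minimum (\<open>variance_attained\<close>).\<close>

definition second_moment :: "'x::metric_space \<Rightarrow> ('x, 'k::real_normed_vector) l2 \<Rightarrow> ennreal"
  where "second_moment y f = (\<Sum>\<^sub>\<infinity>x. ennreal ((dist x y)\<^sup>2 * (norm (l2_apply f x))\<^sup>2))"

definition variance :: "('x::metric_space, 'k::real_normed_vector) l2 \<Rightarrow> ennreal"
  where "variance f = (INF y. second_moment y f)"

lemma variance_attained:
  fixes f :: "('x::metric_space, 'k::real_normed_vector) l2"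
  assumes fin: "\<And>(x::'x) r. finite (cball x r)"
  shows "\<exists>y. variance f = second_moment y f"
proof (cases "(\<exists>y. second_moment y f < \<infinity>) \<and> (\<exists>x. l2_apply f x \<noteq> 0)")
  case True
  then obtain y0 x0 where y0: "second_moment y0 f < \<infinity>" and x0: "l2_apply f x0 \<noteq> 0"
    by blast
  define S where "S = {y. second_moment y f \<le> second_moment y0 f}"
  obtain v where v: "second_moment y0 f = ennreal v" "v \<ge> 0"
    using y0 by (cases "second_moment y0 f") auto
  have "S \<subseteq> cball x0 (sqrt (v / (norm (l2_apply f x0))\<^sup>2))"
  proof
    fix y assume "y \<in> S"
    have "ennreal ((dist x0 y)\<^sup>2 * (norm (l2_apply f x0))\<^sup>2)
        = (\<Sum>x\<in>{x0}. ennreal ((dist x y)\<^sup>2 * (norm (l2_apply f x))\<^sup>2))"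
      by simp
    also have "\<dots> \<le> second_moment y f"
      unfolding second_moment_def
      by (subst nonneg_infsum_complete) (simp, rule SUP_upper, simp)
    also have "\<dots> \<le> ennreal v"
      using \<open>y \<in> S\<close> v by (simp add: S_def)
    finally have "(dist x0 y)\<^sup>2 * (norm (l2_apply f x0))\<^sup>2 \<le> v"
      using v by simp
    then have "(dist x0 y)\<^sup>2 \<le> v / (norm (l2_apply f x0))\<^sup>2"
      using x0 by (simp add: field_simps)
    then show "y \<in> cball x0 (sqrt (v / (norm (l2_apply f x0))\<^sup>2))"
      by (simp add: real_le_rsqrt)
  qed
  then have S: "finite S"
    using fin finite_subset by blast
  have "y0 \<in> S"
    by (simp add: S_def)
  then obtain y where y: "y \<in> S" "\<And>z. z \<in> S \<Longrightarrow> second_moment y f \<le> second_moment z f"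
    using ex_min_if_finite[of "(\<lambda>z. second_moment z f) ` S"] S
    by (smt (verit) emptyE finite_imageI image_iff image_is_empty linorder_not_less)
  have "second_moment y f \<le> second_moment z f" for z
    using y(2)[OF \<open>y0 \<in> S\<close>] y(2)[of z] unfolding S_def mem_Collect_eq by (meson linear order_trans)
  then have "variance f = second_moment y f"
    unfolding variance_def by (intro antisym INF_greatest INF_lower) auto
  then show ?thesis ..
next
  case False
  then have "(\<forall>y. second_moment y f = \<infinity>) \<or> (\<forall>y. second_moment y f = 0)"
    by (cases "\<exists>x. l2_apply f x \<noteq> 0")
      (simp_all add: second_moment_def less_top[symmetric] infinity_ennreal_def)
  then show ?thesis
    by (auto simp: variance_def)
qed

text \<open>An eigenvalue with an eigenvector of finite variance lies in the localized spectrum (constant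
  sequence). Without finite variance this fails: if \<open>A\<close> is the orthogonal projection of \<open>l\<^sup>2(\<int>)\<close>
  onto the line of a unit vector \<open>f\<close> of infinite variance, then 1 is an eigenvalue of \<open>A\<close>, but
  approximate eigenvectors for 1 converge to that line, and their variances are unbounded by lower
  semicontinuity.\<close>

definition localized_spectrum ::
  "(('x::metric_space, 'k::complex_normed_space) l2 \<Rightarrow> ('x, 'k) l2) \<Rightarrow> complex set"
  where "localized_spectrum A = {z. \<exists>f :: nat \<Rightarrow> ('x, 'k) l2.
    (\<forall>n. norm (f n) = 1) \<and>
    (\<lambda>n. norm (A (f n) - z *\<^sub>C f n)) \<longlonglongrightarrow> 0 \<and>
    (\<exists>C::real. \<forall>n. variance (f n) \<le> ennreal C)}"

end

theory Submission
  imports Defs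
begin

text \<open>
  The operator \<open>H\<^sub>0 \<otimes> I\<close> commutes with the unitaries \<open>U\<^sub>\<gamma>\<close>, and \<open>V U\<^sub>\<gamma> = U\<^sub>\<gamma> (V \<circ> \<gamma>)\<close>. Hence
  \<open>U\<^sub>\<gamma>\<close> conjugates \<open>H\<close> into \<open>H\<^sub>0 \<otimes> I + V \<circ> \<gamma>\<close>, while it preserves norms and, as \<open>\<gamma>\<close> is an
  isometric bijection, variances. Given an approximate eigenvector \<open>f\<close> of \<open>K\<close>, almost all of its
  mass lies on a finite set \<open>F\<close>. Pseudo-ergodicity provides a \<open>\<gamma>\<close> such that \<open>V \<circ> \<gamma>\<close> is as close
  to \<open>W\<close> on \<open>F\<close> as desired; off \<open>F\<close> the two potentials differ by at most a constant, as \<open>M\<close> is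
  bounded, and there \<open>f\<close> is small. So \<open>(V \<circ> \<gamma>) f\<close> is close to \<open>W f\<close> (\<open>mult_op_close\<close>), and
  \<open>U\<^sub>\<gamma> f\<close> is an approximate eigenvector of \<open>H\<close> for the same number and with the same variance.
  An eigenvector of \<open>K\<close> with finite variance gives a constant sequence of such vectors \<open>f\<close>, and the
  equality of the localized spectra follows by exchanging the roles of \<open>V\<close> and \<open>W\<close>.

  The remaining work is to show that \<open>A \<otimes> I\<close> exists for every bounded \<open>A\<close> on \<open>l\<^sup>2(X)\<close>, so that
  the description by which it is introduced determines an operator. It is given by the matrix of
  \<open>A\<close>: \<open>((A \<otimes> I) f)(x) = \<Sum>\<^sub>y a(x, y) f(y)\<close>. The bound \<open>\<parallel>A \<otimes> I\<parallel> \<le> \<parallel>A\<parallel>\<close> is first proved for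
  finitely supported \<open>f\<close> (\<open>matrix_amplification_bound\<close>): the values of \<open>f\<close> lie in the span of a
  finite orthonormal set, and \<open>A \<otimes> I\<close> acts as \<open>A\<close> on each coordinate function. This matrix
  formula also shows the commutation with \<open>U\<^sub>\<gamma>\<close>, because invariance of \<open>A\<close> means that
  \<open>a(\<gamma> x, \<gamma> y) = a(x, y)\<close>.
\<close>

section \<open>Complex Hilbert spaces\<close>

instance complex_hilbert_space \<subseteq> banach ..

lemma scaleC_zero_left [simp]: "0 *\<^sub>C x = (0::'a::complex_normed_space)"
  using scaleC_of_real[of 0 x] by simp

lemma scaleC_one [simp]: "1 *\<^sub>C x = (x::'a::complex_normed_space)"
  using scaleC_of_real[of 1 x] by simp

lemma bounded_linear_scaleC_right: "bounded_linear (\<lambda>x::'a::complex_normed_space. c *\<^sub>C x)"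
proof (rule bounded_linear_intro[where K = "cmod c"])
  show "c *\<^sub>C (r *\<^sub>R x) = r *\<^sub>R (c *\<^sub>C x)" for r and x :: 'a
    by (simp add: scaleC_of_real[symmetric] scaleC_scaleC mult.commute)
qed (simp_all add: scaleC_add_right norm_scaleC mult.commute)

lemma bounded_linear_scaleC_left: "bounded_linear (\<lambda>c. c *\<^sub>C (x::'a::complex_normed_space))"
proof (rule bounded_linear_intro[where K = "norm x"])
  show "(r *\<^sub>R c) *\<^sub>C x = r *\<^sub>R (c *\<^sub>C x)" for r and c :: complex
    by (simp add: scaleC_of_real[symmetric] scaleC_scaleC scaleC_complex_def)
qed (simp_all add: scaleC_add_left norm_scaleC)

lemmas scaleC_sum_right = linear_sum[OF bounded_linear.linear[OF bounded_linear_scaleC_right]]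
lemmas scaleC_sum_left = linear_sum[OF bounded_linear.linear[OF bounded_linear_scaleC_left]]

lemma cinner_add_left: "cinner (x + y) z = cinner x z + cinner y (z::'a::complex_hilbert_space)"
  by (metis cinner_add_right cinner_commute complex_cnj_add)

lemma cinner_scaleC_left: "cinner (c *\<^sub>C x) y = cnj c * cinner x (y::'a::complex_hilbert_space)"
  by (metis cinner_commute cinner_scaleC_right complex_cnj_mult)

lemma cinner_zero_right [simp]: "cinner x (0::'a::complex_hilbert_space) = 0"
  using cinner_scaleC_right[of x 0 0] by simp

lemma cinner_zero_left [simp]: "cinner (0::'a::complex_hilbert_space) x = 0"
  using cinner_scaleC_left[of 0 0 x] by simp

lemma cinner_sum_right: "cinner (x::'a::complex_hilbert_space) (sum f S) = (\<Sum>i\<in>S. cinner x (f i))"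
  by (induction S rule: infinite_finite_induct) (simp_all add: cinner_add_right)

lemma cinner_sum_left: "cinner (sum f S) (x::'a::complex_hilbert_space) = (\<Sum>i\<in>S. cinner (f i) x)"
  by (induction S rule: infinite_finite_induct) (simp_all add: cinner_add_left)

lemma cinner_diff_right:
  "cinner x (y - z) = cinner x y - cinner x (z::'a::complex_hilbert_space)"
  using cinner_add_right[of x "y - z" z] by (simp add: algebra_simps)

lemma cinner_self: "cinner x x = complex_of_real ((norm (x::'a::complex_hilbert_space))\<^sup>2)"
proof (rule complex_eqI)
  have "Re (cinner x x) \<ge> 0"
    using norm_eq_sqrt_cinner[of x] norm_ge_zero[of x] by (metis real_sqrt_ge_0_iff)
  then show "Re (cinner x x) = Re (complex_of_real ((norm x)\<^sup>2))"
    by (simp add: norm_eq_sqrt_cinner)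
  show "Im (cinner x x) = Im (complex_of_real ((norm x)\<^sup>2))"
    using arg_cong[OF cinner_commute[of x x], of Im] by simp
qed

definition orthonormal :: "'a::complex_hilbert_space set \<Rightarrow> bool"
  where "orthonormal E \<longleftrightarrow> (\<forall>e\<in>E. \<forall>e'\<in>E. cinner e e' = (if e = e' then 1 else 0))"

lemma orthonormal_pythagoras:
  assumes "finite E" "orthonormal E"
  shows "(norm (\<Sum>e\<in>E. c e *\<^sub>C e))\<^sup>2 = (\<Sum>e\<in>E. (cmod (c e))\<^sup>2)"
proof -
  have "cinner (\<Sum>e\<in>E. c e *\<^sub>C e) (\<Sum>e\<in>E. c e *\<^sub>C e)
      = (\<Sum>e'\<in>E. \<Sum>e\<in>E. c e' * (cnj (c e) * cinner e e'))"
    by (simp add: cinner_sum_left cinner_sum_right cinner_scaleC_left cinner_scaleC_right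
        sum_distrib_left algebra_simps)
  also have "\<dots> = (\<Sum>e'\<in>E. \<Sum>e\<in>E. if e = e' then c e * cnj (c e) else 0)"
    using assms(2) by (intro sum.cong refl) (auto simp: orthonormal_def)
  also have "\<dots> = (\<Sum>e\<in>E. c e * cnj (c e))"
    using assms(1) by simp
  also have "\<dots> = complex_of_real (\<Sum>e\<in>E. (cmod (c e))\<^sup>2)"
    by (simp only: complex_norm_square of_real_sum)
  finally show ?thesis
    unfolding cinner_self of_real_eq_iff .
qed

text \<open>One step of Gram--Schmidt per vector: the residual of the new vector after projection onto
  the span of the set built so far is normalised and added, unless it vanishes.\<close>

lemma finite_subset_orthonormal_span:
  fixes S :: "'a::complex_hilbert_space set"
  assumes "finite S"
  shows "\<exists>E. finite E \<and> orthonormal E \<and> (\<forall>k\<in>S. \<exists>c. k = (\<Sum>e\<in>E. c e *\<^sub>C e))"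
  using assms
proof (induction S)
  case empty
  show ?case
    by (rule exI[of _ "{}"]) (simp add: orthonormal_def)
next
  case (insert v S)
  then obtain E where E: "finite E" "orthonormal E" "\<And>k. k \<in> S \<Longrightarrow> \<exists>c. k = (\<Sum>e\<in>E. c e *\<^sub>C e)"
    by blast
  define r where "r = v - (\<Sum>e\<in>E. cinner e v *\<^sub>C e)"
  show ?case
  proof (cases "r = 0")
    case True
    then have "v = (\<Sum>e\<in>E. cinner e v *\<^sub>C e)"
      by (simp add: r_def)
    then show ?thesis
      using E by auto
  next
    case False
    define u where "u = complex_of_real (inverse (norm r)) *\<^sub>C r"
    have "cinner e r = 0" if "e \<in> E" for e
    proof -
      have "(\<Sum>e'\<in>E. cinner e (cinner e' v *\<^sub>C e')) = (\<Sum>e'\<in>E. if e = e' then cinner e v else 0)"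
        using E(2) that by (intro sum.cong refl) (auto simp: orthonormal_def cinner_scaleC_right)
      then show ?thesis
        using E(1) that by (simp add: r_def cinner_diff_right cinner_sum_right)
    qed
    then have eu: "cinner e u = 0" if "e \<in> E" for e
      using that by (simp add: u_def cinner_scaleC_right)
    then have ue: "cinner u e = 0" if "e \<in> E" for e
      using that cinner_commute[of u e] by simp
    have "norm u = 1"
      using False by (simp add: u_def norm_scaleC norm_inverse)
    then have uu: "cinner u u = 1"
      by (simp add: cinner_self)
    have "u \<notin> E"
      using eu uu by auto
    have "orthonormal (insert u E)"
      using E(2) eu ue uu \<open>u \<notin> E\<close> by (auto simp: orthonormal_def)
    moreover have "\<exists>c. k = (\<Sum>e\<in>insert u E. c e *\<^sub>C e)" if k: "k \<in> insert v S" for k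
    proof -
      have combine: "\<exists>c'. a *\<^sub>C u + (\<Sum>e\<in>E. c e *\<^sub>C e) = (\<Sum>e\<in>insert u E. c' e *\<^sub>C e)" for a c
      proof (rule exI[of _ "c(u := a)"])
        have "(\<Sum>e\<in>E. (c(u := a)) e *\<^sub>C e) = (\<Sum>e\<in>E. c e *\<^sub>C e)"
          using \<open>u \<notin> E\<close> by (intro sum.cong) auto
        then show "a *\<^sub>C u + (\<Sum>e\<in>E. c e *\<^sub>C e) = (\<Sum>e\<in>insert u E. (c(u := a)) e *\<^sub>C e)"
          using E(1) \<open>u \<notin> E\<close> by simp
      qed
      show ?thesis
      proof (cases "k = v")
        case True
        have "complex_of_real (norm r) *\<^sub>C u = r"
          using False by (simp add: u_def scaleC_scaleC)
        then have "k = complex_of_real (norm r) *\<^sub>C u + (\<Sum>e\<in>E. cinner e v *\<^sub>C e)"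
          by (simp add: r_def True)
        then show ?thesis
          using combine by metis
      next
        case False
        then obtain c where "k = (\<Sum>e\<in>E. c e *\<^sub>C e)"
          using E(3) k by blast
        then have "k = 0 *\<^sub>C u + (\<Sum>e\<in>E. c e *\<^sub>C e)"
          by simp
        then show ?thesis
          using combine by metis
      qed
    qed
    ultimately show ?thesis
      using E(1) by (intro exI[of _ "insert u E"]) auto
  qed
qed


section \<open>Finitely supported vectors\<close>

lemma has_sum_norm_l2:
  "((\<lambda>x. (norm (l2_apply f x))\<^sup>2) has_sum (norm (f::('x, 'k::complex_normed_space) l2))\<^sup>2) UNIV"
  by transfer (simp add: infsum_nonneg)

lemma sum_norm_l2_le:
  fixes f :: "('x, 'k::complex_normed_space) l2"
  assumes "finite F"
  shows "(\<Sum>x\<in>F. (norm (l2_apply f x))\<^sup>2) \<le> (norm f)\<^sup>2"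
  using has_sum_norm_l2[of f] assms by (intro finite_sum_le_has_sum[of _ UNIV]) auto

lemma norm_l2_apply_le: "norm (l2_apply f x) \<le> norm (f::('x, 'k::complex_normed_space) l2)"
  using sum_norm_l2_le[of "{x}" f] by (simp add: power2_le_iff_abs_le)

lemma bounded_linear_l2_apply:
  "bounded_linear (\<lambda>f::('x, 'k::complex_normed_space) l2. l2_apply f x)"
  by (rule bounded_linear_intro[where K = 1])
    (simp_all add: plus_l2.rep_eq scaleR_l2.rep_eq norm_l2_apply_le)

lemmas l2_apply_sum = linear_sum[OF bounded_linear.linear[OF bounded_linear_l2_apply]]

lemma l2_eqI: "(\<And>x. l2_apply f x = l2_apply g x) \<Longrightarrow> f = g"
  by (metis ext l2_apply_inject)

lift_definition l2_single :: "'x \<Rightarrow> 'k::complex_normed_space \<Rightarrow> ('x, 'k) l2"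
  is "\<lambda>y k x. if x = y then k else 0"
proof -
  fix y :: 'x and k :: 'k
  have "(\<lambda>x. (norm (if x = y then k else 0))\<^sup>2) summable_on {y}"
    by simp
  then show "(\<lambda>x. (norm (if x = y then k else 0))\<^sup>2) summable_on UNIV"
    by (rule summable_on_cong_neutral[THEN iffD1, rotated 3]) auto
qed

lemma l2_apply_sum_single:
  assumes "finite F"
  shows "l2_apply (\<Sum>y\<in>F. l2_single y (g y)) x = (if x \<in> F then g x else 0)"
  using assms by (simp add: l2_apply_sum l2_single.rep_eq)

lemma norm_sum_single:
  assumes "finite F"
  shows "(norm (\<Sum>y\<in>F. l2_single y (g y)))\<^sup>2 = (\<Sum>y\<in>F. (norm (g y))\<^sup>2)"
proof -
  have "((\<lambda>x. (norm (l2_apply (\<Sum>y\<in>F. l2_single y (g y)) x))\<^sup>2) has_sum (\<Sum>y\<in>F. (norm (g y))\<^sup>2)) UNIV"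
    using assms
    by (intro has_sum_finite_neutralI[of F UNIV]) (auto simp: l2_apply_sum_single intro!: sum.cong)
  then show ?thesis
    using has_sum_norm_l2 has_sum_unique by blast
qed

lemma l2_single_scaleC: "l2_single y (c *\<^sub>C k) = c *\<^sub>C l2_single y k"
  by (rule l2_eqI) (use linear_0[OF bounded_linear.linear[OF bounded_linear_scaleC_right]] in
      \<open>auto simp: l2_single.rep_eq scaleC_l2.rep_eq\<close>)

text \<open>The finitely supported vectors are dense, in the precise form that the restrictions of \<open>f\<close>
  to finite sets converge to \<open>f\<close>.\<close>

lemma has_sum_l2_single:
  fixes f :: "('x, 'k::complex_normed_space) l2"
  shows "((\<lambda>y. l2_single y (l2_apply f y)) has_sum f) UNIV"
proof -
  have sq: "(norm (f - (\<Sum>y\<in>F. l2_single y (l2_apply f y))))\<^sup>2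
      = (norm f)\<^sup>2 - (\<Sum>y\<in>F. (norm (l2_apply f y))\<^sup>2)" if "finite F" for F
  proof -
    let ?g = "f - (\<Sum>y\<in>F. l2_single y (l2_apply f y))"
    have "((\<lambda>x. (norm (l2_apply f x))\<^sup>2) has_sum
        ((norm f)\<^sup>2 - (\<Sum>y\<in>F. (norm (l2_apply f y))\<^sup>2))) (UNIV - F)"
      by (intro has_sum_Diff has_sum_norm_l2) (use that in auto)
    then have "((\<lambda>x. (norm (l2_apply ?g x))\<^sup>2) has_sum
        ((norm f)\<^sup>2 - (\<Sum>y\<in>F. (norm (l2_apply f y))\<^sup>2))) UNIV"
      by (rule has_sum_cong_neutral[THEN iffD1, rotated 3])
        (use that in \<open>auto simp: minus_l2.rep_eq l2_apply_sum_single\<close>)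
    then show ?thesis
      using has_sum_norm_l2 has_sum_unique by blast
  qed
  have "((\<lambda>F. (norm f)\<^sup>2 - (\<Sum>y\<in>F. (norm (l2_apply f y))\<^sup>2)) \<longlongrightarrow> (norm f)\<^sup>2 - (norm f)\<^sup>2)
      (finite_subsets_at_top UNIV)"
    using has_sum_norm_l2[of f] by (intro tendsto_intros) (simp add: has_sum_def)
  then have "((\<lambda>F. sqrt ((norm f)\<^sup>2 - (\<Sum>y\<in>F. (norm (l2_apply f y))\<^sup>2))) \<longlongrightarrow> 0)
      (finite_subsets_at_top UNIV)"
    using tendsto_real_sqrt by fastforce
  moreover have "\<forall>\<^sub>F F in finite_subsets_at_top UNIV.
      sqrt ((norm f)\<^sup>2 - (\<Sum>y\<in>F. (norm (l2_apply f y))\<^sup>2))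
      = norm ((\<Sum>y\<in>F. l2_single y (l2_apply f y)) - f)"
    by (rule eventually_finite_subsets_at_top_weakI)
      (simp add: norm_minus_commute flip: sq)
  ultimately have "((\<lambda>F. norm ((\<Sum>y\<in>F. l2_single y (l2_apply f y)) - f)) \<longlongrightarrow> 0)
      (finite_subsets_at_top UNIV)"
    by (rule Lim_transform_eventually)
  then show ?thesis
    unfolding has_sum_def by (rule LIM_zero_cancel[OF tendsto_norm_zero_cancel])
qed

lemma bounded_linear_l2_has_sum:
  fixes T :: "('x, 'k::complex_normed_space) l2 \<Rightarrow> 'b::real_normed_vector"
  assumes "bounded_linear T"
  shows "((\<lambda>y. T (l2_single y (l2_apply f y))) has_sum T f) UNIV"
  using has_sum_bounded_linear[OF assms has_sum_l2_single[of f]] by (simp add: o_def)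


section \<open>The operator \<open>A \<otimes> I\<close>\<close>

definition matrix_entry :: "(('x, complex) l2 \<Rightarrow> ('x, complex) l2) \<Rightarrow> 'x \<Rightarrow> 'x \<Rightarrow> complex"
  where "matrix_entry A x y = l2_apply (A (l2_single y 1)) x"

lemma l2_apply_single_eq_matrix_entry:
  assumes "bounded_clinear A"
  shows "l2_apply (A (l2_single y c)) x = matrix_entry A x y * c"
proof -
  have "l2_single y c = c *\<^sub>C l2_single y 1"
    using l2_single_scaleC[of y c "1::complex"] by (simp add: scaleC_complex_def)
  then show ?thesis
    using assms by (simp add: bounded_clinear_def matrix_entry_def scaleC_l2.rep_eq scaleC_complex_def)
qed

lemma matrix_entry_has_sum:
  assumes "bounded_clinear A"
  shows "((\<lambda>y. matrix_entry A x y * l2_apply f y) has_sum l2_apply (A f) x) UNIV"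
proof -
  have "bounded_linear (\<lambda>f. l2_apply (A f) x)"
    using assms bounded_linear_compose[OF bounded_linear_l2_apply] by (auto simp: bounded_clinear_def)
  from bounded_linear_l2_has_sum[OF this, of f] show ?thesis
    by (simp add: l2_apply_single_eq_matrix_entry[OF assms])
qed

text \<open>A row of the matrix represents the bounded functional \<open>f \<mapsto> (A f)(x)\<close>, so it is square
  summable. The proof evaluates this functional on the conjugate of a finite piece of the row.\<close>

lemma matrix_row_summable:
  assumes A: "bounded_clinear A"
  shows "(\<lambda>y. (cmod (matrix_entry A x y))\<^sup>2) summable_on UNIV"
proof -
  obtain C where C: "\<And>f. norm (A f) \<le> norm f * C"
    using A bounded_linear.bounded unfolding bounded_clinear_def by blast
  have "(\<Sum>y\<in>F. (cmod (matrix_entry A x y))\<^sup>2) \<le> C\<^sup>2" if F: "finite F" for F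
  proof -
    define s where "s = (\<Sum>y\<in>F. (cmod (matrix_entry A x y))\<^sup>2)"
    define u where "u = (\<Sum>y\<in>F. l2_single y (cnj (matrix_entry A x y)))"
    have s0: "s \<ge> 0"
      by (simp add: s_def sum_nonneg)
    have "A u = (\<Sum>y\<in>F. A (l2_single y (cnj (matrix_entry A x y))))"
      using A unfolding u_def by (simp add: bounded_clinear_def bounded_linear.linear linear_sum)
    then have "l2_apply (A u) x = complex_of_real s"
      by (simp add: l2_apply_sum l2_apply_single_eq_matrix_entry[OF A] s_def
          complex_norm_square[symmetric] del: of_real_power)
    then have "s \<le> norm (A u)"
      using norm_l2_apply_le[of "A u" x] s0 by simp
    also have "\<dots> \<le> norm u * C"
      by (rule C)
    finally have "s\<^sup>2 \<le> (norm u)\<^sup>2 * C\<^sup>2"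
      using s0 power_mono[of s "norm u * C" 2] by (simp add: power_mult_distrib)
    also have "(norm u)\<^sup>2 = s"
      unfolding u_def norm_sum_single[OF F] by (simp add: s_def)
    finally have "s * s \<le> s * C\<^sup>2"
      by (simp add: power2_eq_square)
    then show ?thesis
      using s0 unfolding s_def[symmetric] by (cases "s = 0") auto
  qed
  then show ?thesis
    by (intro nonneg_bdd_above_summable_on) (auto intro!: bdd_aboveI2)
qed

text \<open>The values \<open>k y\<close> are expanded in a finite orthonormal set \<open>E\<close>, with coordinate functions \<open>u e\<close>
  for \<open>e \<in> E\<close>. The matrix acts on each coordinate function by \<open>A\<close>, and Pythagoras adds up the
  squared norms of the coordinates before and after.\<close>

lemma matrix_amplification_bound:
  fixes k :: "'x \<Rightarrow> 'k::complex_hilbert_space"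
  assumes A: "bounded_clinear A" and C: "\<And>f. norm (A f) \<le> norm f * C"
    and F: "finite F" and S: "finite S"
  shows "(\<Sum>x\<in>F. (norm (\<Sum>y\<in>S. matrix_entry A x y *\<^sub>C k y))\<^sup>2) \<le> C\<^sup>2 * (\<Sum>y\<in>S. (norm (k y))\<^sup>2)"
proof -
  obtain E where E: "finite E" "orthonormal E" "\<forall>v\<in>k ` S. \<exists>c. v = (\<Sum>e\<in>E. c e *\<^sub>C e)"
    using finite_subset_orthonormal_span[of "k ` S"] S by auto
  then have "\<forall>y\<in>S. \<exists>c. k y = (\<Sum>e\<in>E. c e *\<^sub>C e)"
    by simp
  from bchoice[OF this] obtain c where c: "\<And>y. y \<in> S \<Longrightarrow> k y = (\<Sum>e\<in>E. c y e *\<^sub>C e)"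
    by blast
  define u where "u e = (\<Sum>y\<in>S. l2_single y (c y e))" for e
  have Au: "l2_apply (A (u e)) x = (\<Sum>y\<in>S. matrix_entry A x y * c y e)" for e x
  proof -
    have "A (u e) = (\<Sum>y\<in>S. A (l2_single y (c y e)))"
      using A unfolding u_def by (simp add: bounded_clinear_def bounded_linear.linear linear_sum)
    then show ?thesis
      by (simp add: l2_apply_sum l2_apply_single_eq_matrix_entry[OF A])
  qed
  have "(\<Sum>y\<in>S. matrix_entry A x y *\<^sub>C k y) = (\<Sum>e\<in>E. l2_apply (A (u e)) x *\<^sub>C e)" for x
  proof -
    have "(\<Sum>y\<in>S. matrix_entry A x y *\<^sub>C k y)
        = (\<Sum>y\<in>S. \<Sum>e\<in>E. (matrix_entry A x y * c y e) *\<^sub>C e)"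
      by (intro sum.cong refl) (simp add: c scaleC_sum_right scaleC_scaleC)
    also have "\<dots> = (\<Sum>e\<in>E. \<Sum>y\<in>S. (matrix_entry A x y * c y e) *\<^sub>C e)"
      by (rule sum.swap)
    finally show ?thesis
      by (simp add: Au scaleC_sum_left)
  qed
  then have "(\<Sum>x\<in>F. (norm (\<Sum>y\<in>S. matrix_entry A x y *\<^sub>C k y))\<^sup>2)
      = (\<Sum>x\<in>F. \<Sum>e\<in>E. (cmod (l2_apply (A (u e)) x))\<^sup>2)"
    by (simp add: orthonormal_pythagoras[OF E(1,2)])
  also have "\<dots> = (\<Sum>e\<in>E. \<Sum>x\<in>F. (cmod (l2_apply (A (u e)) x))\<^sup>2)"
    by (rule sum.swap)
  also have "\<dots> \<le> (\<Sum>e\<in>E. C\<^sup>2 * (norm (u e))\<^sup>2)"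
  proof (rule sum_mono)
    fix e
    have "(\<Sum>x\<in>F. (cmod (l2_apply (A (u e)) x))\<^sup>2) \<le> (norm (A (u e)))\<^sup>2"
      by (rule sum_norm_l2_le[OF F])
    also have "\<dots> \<le> C\<^sup>2 * (norm (u e))\<^sup>2"
      using power_mono[OF C[of "u e"], of 2] by (simp add: power_mult_distrib mult.commute)
    finally show "(\<Sum>x\<in>F. (cmod (l2_apply (A (u e)) x))\<^sup>2) \<le> C\<^sup>2 * (norm (u e))\<^sup>2" .
  qed
  also have "\<dots> = C\<^sup>2 * (\<Sum>e\<in>E. \<Sum>y\<in>S. (cmod (c y e))\<^sup>2)"
    unfolding u_def norm_sum_single[OF S] by (simp add: sum_distrib_left)
  also have "\<dots> = C\<^sup>2 * (\<Sum>y\<in>S. \<Sum>e\<in>E. (cmod (c y e))\<^sup>2)"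
    by (subst sum.swap) (rule refl)
  also have "\<dots> = C\<^sup>2 * (\<Sum>y\<in>S. (norm (k y))\<^sup>2)"
    by (simp add: c orthonormal_pythagoras[OF E(1,2)])
  finally show ?thesis .
qed

definition amplify ::
  "(('x, complex) l2 \<Rightarrow> ('x, complex) l2) \<Rightarrow> ('x, 'k::complex_hilbert_space) l2 \<Rightarrow> ('x, 'k) l2"
  where "amplify A f = Abs_l2 (\<lambda>x. \<Sum>\<^sub>\<infinity>y. matrix_entry A x y *\<^sub>C l2_apply f y)"

text \<open>The defining series converges absolutely by Cauchy--Schwarz, as a matrix row and \<open>f\<close> are both
  square summable. For a finite set of points \<open>x\<close> it is the limit of its partial sums over finite
  sets of \<open>y\<close>, so the bound for finitely supported vectors carries over to all \<open>f\<close>.\<close>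

lemma
  fixes f :: "('x, 'k::complex_hilbert_space) l2"
  assumes A: "bounded_clinear A"
  shows amplify_has_sum:
      "((\<lambda>y. matrix_entry A x y *\<^sub>C l2_apply f y) has_sum l2_apply (amplify A f) x) UNIV"
    and norm_amplify_le: "(\<And>f. norm (A f) \<le> norm f * C) \<Longrightarrow> (norm (amplify A f))\<^sup>2 \<le> (norm f * C)\<^sup>2"
proof -
  define g where "g x = (\<Sum>\<^sub>\<infinity>y. matrix_entry A x y *\<^sub>C l2_apply f y)" for x
  have g: "((\<lambda>y. matrix_entry A x y *\<^sub>C l2_apply f y) has_sum g x) UNIV" for x
  proof -
    have "(\<lambda>y. (cmod (matrix_entry A x y))\<^sup>2 + (norm (l2_apply f y))\<^sup>2) summable_on UNIV"
      using l2_apply[of f] by (intro summable_on_add matrix_row_summable A) simp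
    moreover have "norm (matrix_entry A x y *\<^sub>C l2_apply f y)
        \<le> (cmod (matrix_entry A x y))\<^sup>2 + (norm (l2_apply f y))\<^sup>2" for y
    proof -
      have "0 \<le> cmod (matrix_entry A x y) * norm (l2_apply f y)"
        by simp
      then show ?thesis
        using sum_squares_bound[of "cmod (matrix_entry A x y)" "norm (l2_apply f y)"]
        unfolding norm_scaleC by linarith
    qed
    ultimately have "(\<lambda>y. norm (matrix_entry A x y *\<^sub>C l2_apply f y)) summable_on UNIV"
      by (rule summable_on_comparison_test) simp_all
    then have "(\<lambda>y. matrix_entry A x y *\<^sub>C l2_apply f y) summable_on UNIV"
      by (rule abs_summable_summable)
    then show ?thesis
      unfolding g_def by (rule has_sum_infsum)
  qed
  have fin: "(\<Sum>x\<in>F. (norm (g x))\<^sup>2) \<le> (norm f * C)\<^sup>2"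
    if "finite F" and C: "\<And>f. norm (A f) \<le> norm f * C" for F C
  proof (rule tendsto_upperbound)
    show "((\<lambda>S. \<Sum>x\<in>F. (norm (\<Sum>y\<in>S. matrix_entry A x y *\<^sub>C l2_apply f y))\<^sup>2)
        \<longlongrightarrow> (\<Sum>x\<in>F. (norm (g x))\<^sup>2)) (finite_subsets_at_top UNIV)"
      using g by (intro tendsto_intros) (simp add: has_sum_def)
    show "\<forall>\<^sub>F S in finite_subsets_at_top UNIV.
        (\<Sum>x\<in>F. (norm (\<Sum>y\<in>S. matrix_entry A x y *\<^sub>C l2_apply f y))\<^sup>2) \<le> (norm f * C)\<^sup>2"
    proof (rule eventually_finite_subsets_at_top_weakI)
      fix S :: "'x set" assume S: "finite S"
      have "(\<Sum>x\<in>F. (norm (\<Sum>y\<in>S. matrix_entry A x y *\<^sub>C l2_apply f y))\<^sup>2)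
          \<le> C\<^sup>2 * (\<Sum>y\<in>S. (norm (l2_apply f y))\<^sup>2)"
        by (rule matrix_amplification_bound[OF A C \<open>finite F\<close> S])
      also have "\<dots> \<le> C\<^sup>2 * (norm f)\<^sup>2"
        by (intro mult_left_mono sum_norm_l2_le S) simp
      finally show "(\<Sum>x\<in>F. (norm (\<Sum>y\<in>S. matrix_entry A x y *\<^sub>C l2_apply f y))\<^sup>2) \<le> (norm f * C)\<^sup>2"
        by (simp add: power_mult_distrib mult.commute)
    qed
  qed simp
  obtain C0 where "\<And>f. norm (A f) \<le> norm f * C0"
    using A bounded_linear.bounded unfolding bounded_clinear_def by blast
  then have "(\<lambda>x. (norm (g x))\<^sup>2) summable_on UNIV"
    by (intro nonneg_bdd_above_summable_on) (auto intro!: bdd_aboveI2 fin)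
  then have apply_eq: "l2_apply (amplify A f) = g"
    by (simp add: amplify_def g_def[abs_def] Abs_l2_inverse)
  show "((\<lambda>y. matrix_entry A x y *\<^sub>C l2_apply f y) has_sum l2_apply (amplify A f) x) UNIV"
    unfolding apply_eq by (rule g)
  show "(norm (amplify A f))\<^sup>2 \<le> (norm f * C)\<^sup>2" if "\<And>f. norm (A f) \<le> norm f * C"
    using has_sum_norm_l2[of "amplify A f"] unfolding apply_eq
    by (rule has_sum_le_finite_sums) (rule fin[OF _ that])
qed

lemma bounded_clinear_amplify:
  assumes A: "bounded_clinear A"
  shows "bounded_clinear (amplify A :: ('x, 'k::complex_hilbert_space) l2 \<Rightarrow> _)"
proof -
  note hs = amplify_has_sum[OF A]
  have add: "amplify A (f + g) = amplify A f + amplify A g" for f g :: "('x, 'k) l2"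
  proof (rule l2_eqI)
    fix x
    show "l2_apply (amplify A (f + g)) x = l2_apply (amplify A f + amplify A g) x"
      using has_sum_unique[OF hs[of x "f + g"]] has_sum_add[OF hs[of x f] hs[of x g]]
      by (simp add: plus_l2.rep_eq scaleC_add_right)
  qed
  have scale: "amplify A (c *\<^sub>C f) = c *\<^sub>C amplify A f" for c and f :: "('x, 'k) l2"
  proof (rule l2_eqI)
    fix x
    show "l2_apply (amplify A (c *\<^sub>C f)) x = l2_apply (c *\<^sub>C amplify A f) x"
      using has_sum_unique[OF hs[of x "c *\<^sub>C f"]]
        has_sum_bounded_linear[OF bounded_linear_scaleC_right[of c] hs[of x f]]
      by (simp add: scaleC_l2.rep_eq scaleC_scaleC o_def mult.commute)
  qed
  obtain C where C: "C \<ge> 0" "\<And>f. norm (A f) \<le> norm f * C"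
    using A bounded_linear.nonneg_bounded by (metis bounded_clinear_def)
  have "bounded_linear (amplify A :: ('x, 'k) l2 \<Rightarrow> _)"
  proof (rule bounded_linear_intro[where K = C])
    show "amplify A (r *\<^sub>R f) = r *\<^sub>R amplify A f" for r and f :: "('x, 'k) l2"
      using scale[of "complex_of_real r" f] by (simp add: scaleC_of_real)
    show "norm (amplify A f) \<le> norm f * C" for f :: "('x, 'k) l2"
      by (rule power2_le_imp_le[OF norm_amplify_le[OF A C(2)]]) (simp add: C(1))
  qed (rule add)
  then show ?thesis
    using scale by (simp add: bounded_clinear_def)
qed

lemma amplify_pure_tensor:
  assumes "bounded_clinear A"
  shows "amplify A (f \<otimes>\<^sub>2 k) = A f \<otimes>\<^sub>2 (k :: 'k::complex_hilbert_space)"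
proof (rule l2_eqI)
  fix x
  show "l2_apply (amplify A (f \<otimes>\<^sub>2 k)) x = l2_apply (A f \<otimes>\<^sub>2 k) x"
    using has_sum_unique[OF amplify_has_sum[OF assms, of x "f \<otimes>\<^sub>2 k"]]
      has_sum_bounded_linear[OF bounded_linear_scaleC_left[of k] matrix_entry_has_sum[OF assms, of x f]]
    by (simp add: pure_tensor.rep_eq scaleC_scaleC o_def)
qed

lemma pure_tensor_single: "l2_single y 1 \<otimes>\<^sub>2 k = l2_single y k"
  by (rule l2_eqI) (simp add: pure_tensor.rep_eq l2_single.rep_eq)

text \<open>Uniqueness of \<open>A \<otimes> I\<close> comes from the density of the span of the vectors \<open>l2_single y k\<close>, which
  are pure tensors.\<close>

lemma tensor_id_eq_amplify:
  assumes A: "bounded_clinear A"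
  shows "(tensor_id A :: ('x, 'k::complex_hilbert_space) l2 \<Rightarrow> _) = amplify A"
  unfolding tensor_id_def
proof (rule the_equality)
  show "bounded_clinear (amplify A :: ('x, 'k) l2 \<Rightarrow> _)
      \<and> (\<forall>f k. amplify A (f \<otimes>\<^sub>2 k) = A f \<otimes>\<^sub>2 (k :: 'k))"
    using A by (simp add: bounded_clinear_amplify amplify_pure_tensor)
next
  fix T :: "('x, 'k) l2 \<Rightarrow> ('x, 'k) l2"
  assume T: "bounded_clinear T \<and> (\<forall>f k. T (f \<otimes>\<^sub>2 k) = A f \<otimes>\<^sub>2 k)"
  have "T (l2_single y k) = amplify A (l2_single y k)" for y k
    using T amplify_pure_tensor[OF A] by (metis pure_tensor_single)
  then show "T = amplify A"
    using bounded_linear_l2_has_sum[of T] bounded_linear_l2_has_sum[of "amplify A"]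
      T bounded_clinear_amplify[OF A]
    by (metis (no_types, lifting) ext bounded_clinear_def has_sum_unique)
qed


section \<open>Translations\<close>

lemma group_action_inv_apply:
  assumes "group_action G UNIV \<phi>" "\<gamma> \<in> carrier G"
  shows "\<phi> (inv\<^bsub>G\<^esub> \<gamma>) (\<phi> \<gamma> x) = x" "\<phi> \<gamma> (\<phi> (inv\<^bsub>G\<^esub> \<gamma>) x) = x"
proof -
  interpret group_action G UNIV \<phi> by fact
  have "group G"
    using group_hom by (simp add: group_hom_def)
  then have "inv\<^bsub>G\<^esub> \<gamma> \<in> carrier G" "inv\<^bsub>G\<^esub> (inv\<^bsub>G\<^esub> \<gamma>) = \<gamma>"
    using assms(2) by (simp_all add: group.inv_inv)
  then show "\<phi> (inv\<^bsub>G\<^esub> \<gamma>) (\<phi> \<gamma> x) = x" "\<phi> \<gamma> (\<phi> (inv\<^bsub>G\<^esub> \<gamma>) x) = x"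
    using orbit_sym_aux[of \<gamma> x] orbit_sym_aux[of "inv\<^bsub>G\<^esub> \<gamma>" x] assms(2) by auto
qed

lemma group_action_bij:
  assumes "group_action G UNIV \<phi>" "\<gamma> \<in> carrier G"
  shows "bij (\<phi> \<gamma>)"
  by (rule bijI') (use group_action_inv_apply[OF assms] in metis)+

context
  fixes G :: "('g, 'm) monoid_scheme" and \<phi> :: "'g \<Rightarrow> 'x \<Rightarrow> 'x" and \<gamma> :: 'g
  assumes action: "group_action G UNIV \<phi>" and \<gamma>: "\<gamma> \<in> carrier G"
begin

lemma translate_op_at_moved_point:
  "l2_apply (translate_op G \<phi> \<gamma> f) (\<phi> \<gamma> x) = l2_apply (f :: ('x, 'k::real_normed_vector) l2) x"
  by (simp add: l2_apply_translate_op[OF action \<gamma>] group_action_inv_apply[OF action \<gamma>])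

lemma l2_eqI_moved_points:
  assumes "\<And>x. l2_apply f (\<phi> \<gamma> x) = l2_apply g (\<phi> \<gamma> x)"
  shows "f = g"
  by (rule l2_eqI) (metis assms group_action_inv_apply(2)[OF action \<gamma>])

lemma norm_translate_op:
  "norm (translate_op G \<phi> \<gamma> f) = norm (f :: ('x, 'k::complex_normed_space) l2)"
proof -
  have "(\<Sum>\<^sub>\<infinity>x. (norm (l2_apply (translate_op G \<phi> \<gamma> f) (\<phi> \<gamma> x)))\<^sup>2)
      = (\<Sum>\<^sub>\<infinity>x. (norm (l2_apply (translate_op G \<phi> \<gamma> f) x))\<^sup>2)"
    by (rule infsum_reindex_bij_betw[OF group_action_bij[OF action \<gamma>]])
  then show ?thesis
    by (simp add: norm_l2.rep_eq translate_op_at_moved_point)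
qed

lemma translate_op_add:
  "translate_op G \<phi> \<gamma> (f + g) = translate_op G \<phi> \<gamma> f
    + translate_op G \<phi> \<gamma> (g :: ('x, 'k::complex_normed_space) l2)"
  by (rule l2_eqI) (simp add: l2_apply_translate_op[OF action \<gamma>] plus_l2.rep_eq)

lemma translate_op_diff:
  "translate_op G \<phi> \<gamma> (f - g) = translate_op G \<phi> \<gamma> f
    - translate_op G \<phi> \<gamma> (g :: ('x, 'k::complex_normed_space) l2)"
  by (rule l2_eqI) (simp add: l2_apply_translate_op[OF action \<gamma>] minus_l2.rep_eq)

lemma translate_op_scaleC:
  "translate_op G \<phi> \<gamma> (c *\<^sub>C f) = c *\<^sub>C translate_op G \<phi> \<gamma> (f :: ('x, 'k::complex_normed_space) l2)"
  by (rule l2_eqI) (simp add: l2_apply_translate_op[OF action \<gamma>] scaleC_l2.rep_eq)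

lemma translate_op_single: "translate_op G \<phi> \<gamma> (l2_single y k) = l2_single (\<phi> \<gamma> y) k"
  by (rule l2_eqI_moved_points)
    (use group_action_bij[OF action \<gamma>] in
      \<open>auto simp: translate_op_at_moved_point l2_single.rep_eq bij_def inj_eq\<close>)

text \<open>Commutation on \<open>l\<^sup>2(X)\<close> says that the matrix of \<open>A\<close> is constant along the diagonal action of
  \<open>\<gamma>\<close> on \<open>X \<times> X\<close>. The commutation on \<open>l\<^sup>2(X, K)\<close> is then a change of the summation variable in
  the matrix formula.\<close>

lemma tensor_id_translate_op:
  fixes f :: "('x, 'k::complex_hilbert_space) l2"
  assumes A: "bounded_clinear A"
    and comm: "\<And>f. A (translate_op G \<phi> \<gamma> f) = translate_op G \<phi> \<gamma> (A f)"
  shows "tensor_id A (translate_op G \<phi> \<gamma> f) = translate_op G \<phi> \<gamma> (tensor_id A f)"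
  unfolding tensor_id_eq_amplify[OF A]
proof (rule l2_eqI_moved_points)
  fix x
  have entry: "matrix_entry A (\<phi> \<gamma> x) (\<phi> \<gamma> y) = matrix_entry A x y" for y
    using comm[of "l2_single y 1"]
    by (simp add: matrix_entry_def translate_op_single translate_op_at_moved_point)
  let ?h = "\<lambda>y. matrix_entry A (\<phi> \<gamma> x) y *\<^sub>C l2_apply (translate_op G \<phi> \<gamma> f) y"
  have "(?h has_sum l2_apply (amplify A (translate_op G \<phi> \<gamma> f)) (\<phi> \<gamma> x)) UNIV"
    by (rule amplify_has_sum[OF A])
  then have "((\<lambda>y. ?h (\<phi> \<gamma> y)) has_sum l2_apply (amplify A (translate_op G \<phi> \<gamma> f)) (\<phi> \<gamma> x)) UNIV"
    using has_sum_reindex_bij_betw[OF group_action_bij[OF action \<gamma>], of ?h] by simp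
  then have "l2_apply (amplify A (translate_op G \<phi> \<gamma> f)) (\<phi> \<gamma> x) = l2_apply (amplify A f) x"
    using amplify_has_sum[OF A, of x f]
    by (simp add: entry translate_op_at_moved_point has_sum_unique)
  then show "l2_apply (amplify A (translate_op G \<phi> \<gamma> f)) (\<phi> \<gamma> x)
      = l2_apply (translate_op G \<phi> \<gamma> (amplify A f)) (\<phi> \<gamma> x)"
    by (simp add: translate_op_at_moved_point)
qed

lemma mult_op_translate_op:
  fixes V :: "'x \<Rightarrow> 'k \<Rightarrow>\<^sub>L 'k::complex_hilbert_space"
  assumes "bounded (range V)"
  shows "mult_op V (translate_op G \<phi> \<gamma> f) = translate_op G \<phi> \<gamma> (mult_op (V \<circ> \<phi> \<gamma>) f)"
proof (rule l2_eqI_moved_points)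
  fix x
  have "bounded (range (V \<circ> \<phi> \<gamma>))"
    by (rule bounded_subset[OF assms]) auto
  then show "l2_apply (mult_op V (translate_op G \<phi> \<gamma> f)) (\<phi> \<gamma> x)
      = l2_apply (translate_op G \<phi> \<gamma> (mult_op (V \<circ> \<phi> \<gamma>) f)) (\<phi> \<gamma> x)"
    using assms by (simp add: l2_apply_mult_op translate_op_at_moved_point)
qed

end

lemma variance_translate_op_le:
  fixes \<phi> :: "'g \<Rightarrow> 'x::metric_space \<Rightarrow> 'x" and f :: "('x, 'k::real_normed_vector) l2"
  assumes action: "group_action G UNIV \<phi>" and \<gamma>: "\<gamma> \<in> carrier G"
    and iso: "\<And>x y. dist (\<phi> \<gamma> x) (\<phi> \<gamma> y) = dist x y"
  shows "variance (translate_op G \<phi> \<gamma> f) \<le> variance f"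
  unfolding variance_def
proof (rule INF_greatest)
  fix y
  let ?h = "\<lambda>x. ennreal ((dist x (\<phi> \<gamma> y))\<^sup>2 * (norm (l2_apply (translate_op G \<phi> \<gamma> f) x))\<^sup>2)"
  have "(\<Sum>\<^sub>\<infinity>x. ?h (\<phi> \<gamma> x)) = (\<Sum>\<^sub>\<infinity>x. ?h x)"
    by (rule infsum_reindex_bij_betw[OF group_action_bij[OF action \<gamma>]])
  then have "second_moment (\<phi> \<gamma> y) (translate_op G \<phi> \<gamma> f) = second_moment y f"
    by (simp add: second_moment_def iso translate_op_at_moved_point[OF action \<gamma>])
  then show "(INF y. second_moment y (translate_op G \<phi> \<gamma> f)) \<le> second_moment y f"
    by (metis INF_lower UNIV_I)
qed


section \<open>Transfer of approximate eigenvectors\<close>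

text \<open>On \<open>F\<close> the potentials differ by at most \<open>\<epsilon>\<close>, elsewhere by at most \<open>2 B\<close>. The hypothesis on \<open>\<delta>\<close>
  controls the second contribution through the mass of \<open>f\<close> outside \<open>F\<close>.\<close>

lemma mult_op_close:
  fixes W V :: "'x \<Rightarrow> 'k \<Rightarrow>\<^sub>L 'k::complex_hilbert_space"
  assumes W: "range W \<subseteq> M" and V: "range V \<subseteq> M" and M: "\<And>T. T \<in> M \<Longrightarrow> norm T \<le> B"
    and F: "finite F" and close: "\<And>x. x \<in> F \<Longrightarrow> norm (W x - V x) \<le> \<epsilon>"
    and tail: "4 * B\<^sup>2 * ((norm f)\<^sup>2 - (\<Sum>x\<in>F. (norm (l2_apply f x))\<^sup>2)) \<le> \<delta>"
  shows "(norm (mult_op V f - mult_op W f))\<^sup>2 \<le> \<epsilon>\<^sup>2 * (norm f)\<^sup>2 + \<delta>"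
proof -
  let ?n = "\<lambda>x. (norm (l2_apply f x))\<^sup>2"
  have bd: "bounded (range W)" "bounded (range V)"
    using W V M by (auto intro!: boundedI M)
  have diff: "norm (l2_apply (mult_op V f - mult_op W f) x) \<le> norm (W x - V x) * norm (l2_apply f x)"
    for x
    using norm_blinfun[of "V x - W x" "l2_apply f x"] bd
    by (simp add: minus_l2.rep_eq l2_apply_mult_op blinfun.diff_left norm_minus_commute)
  have global: "norm (W x - V x) \<le> 2 * B" for x
    using norm_triangle_ineq4[of "W x" "V x"] M[of "W x"] M[of "V x"] W V by fastforce
  have pointwise: "(norm (l2_apply (mult_op V f - mult_op W f) x))\<^sup>2 \<le> c\<^sup>2 * ?n x"
    if "norm (W x - V x) \<le> c" for x c
    using power_mono[OF order.trans[OF diff[of x] mult_right_mono[OF that]], where n = 2]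
    by (simp add: power_mult_distrib)
  show ?thesis
    using has_sum_norm_l2[of "mult_op V f - mult_op W f"]
  proof (rule has_sum_le_finite_sums)
    fix S :: "'x set" assume S: "finite S"
    have "(\<Sum>x\<in>S \<union> F. ?n x) = (\<Sum>x\<in>F. ?n x) + (\<Sum>x\<in>S - F. ?n x)"
      using S F by (metis Un_Diff_cancel Un_commute sum.union_disjoint finite_Diff Diff_disjoint)
    then have out: "(\<Sum>x\<in>S - F. ?n x) \<le> (norm f)\<^sup>2 - (\<Sum>x\<in>F. ?n x)"
      using sum_norm_l2_le[of "S \<union> F" f] S F by simp
    have "(\<Sum>x\<in>S. (norm (l2_apply (mult_op V f - mult_op W f) x))\<^sup>2)
        = (\<Sum>x\<in>S \<inter> F. (norm (l2_apply (mult_op V f - mult_op W f) x))\<^sup>2)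
        + (\<Sum>x\<in>S - F. (norm (l2_apply (mult_op V f - mult_op W f) x))\<^sup>2)"
      using S by (rule sum.Int_Diff)
    also have "\<dots> \<le> (\<Sum>x\<in>S \<inter> F. \<epsilon>\<^sup>2 * ?n x) + (\<Sum>x\<in>S - F. (2 * B)\<^sup>2 * ?n x)"
      by (intro add_mono sum_mono pointwise) (use close global in auto)
    also have "\<dots> = \<epsilon>\<^sup>2 * (\<Sum>x\<in>S \<inter> F. ?n x) + 4 * B\<^sup>2 * (\<Sum>x\<in>S - F. ?n x)"
      by (simp add: sum_distrib_left power_mult_distrib)
    also have "\<dots> \<le> \<epsilon>\<^sup>2 * (norm f)\<^sup>2 + 4 * B\<^sup>2 * ((norm f)\<^sup>2 - (\<Sum>x\<in>F. ?n x))"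
      by (intro add_mono mult_left_mono out sum_norm_l2_le) (use S in auto)
    also have "\<dots> \<le> \<epsilon>\<^sup>2 * (norm f)\<^sup>2 + \<delta>"
      using tail by simp
    finally show "(\<Sum>x\<in>S. (norm (l2_apply (mult_op V f - mult_op W f) x))\<^sup>2) \<le> \<epsilon>\<^sup>2 * (norm f)\<^sup>2 + \<delta>" .
  qed
qed

text \<open>Pseudo-ergodicity only compares potentials on finite sets. On a fixed vector \<open>f\<close> this already
  yields approximation in norm: \<open>F\<close> is chosen so large that the mass of \<open>f\<close> outside it contributes
  at most \<open>\<epsilon>\<^sup>2\<close> to the squared norm, and only then \<open>\<gamma>\<close> is chosen for \<open>F\<close>.\<close>

lemma pseudo_ergodic_approximates:
  fixes V W :: "'x \<Rightarrow> 'k \<Rightarrow>\<^sub>L 'k::complex_hilbert_space" and f :: "('x, 'k) l2"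
  assumes V: "pseudo_ergodic G \<phi> M V" and W: "range W \<subseteq> M" and M: "bounded M" and "\<epsilon> > 0"
  shows "\<exists>\<gamma>\<in>carrier G. norm (mult_op (V \<circ> \<phi> \<gamma>) f - mult_op W f) \<le> \<epsilon> * (norm f + 1)"
proof -
  obtain B where B: "\<And>T. T \<in> M \<Longrightarrow> norm T \<le> B"
    using M by (auto simp: bounded_iff)
  have "((\<lambda>F. 4 * B\<^sup>2 * ((norm f)\<^sup>2 - (\<Sum>x\<in>F. (norm (l2_apply f x))\<^sup>2)))
      \<longlongrightarrow> 4 * B\<^sup>2 * ((norm f)\<^sup>2 - (norm f)\<^sup>2)) (finite_subsets_at_top UNIV)"
    using has_sum_norm_l2[of f] by (intro tendsto_intros) (simp add: has_sum_def)
  then have "\<forall>\<^sub>F F in finite_subsets_at_top UNIV.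
      4 * B\<^sup>2 * ((norm f)\<^sup>2 - (\<Sum>x\<in>F. (norm (l2_apply f x))\<^sup>2)) < \<epsilon>\<^sup>2"
    by (rule order_tendstoD(2)) (use \<open>\<epsilon> > 0\<close> in simp)
  then obtain F where F: "finite F"
    "4 * B\<^sup>2 * ((norm f)\<^sup>2 - (\<Sum>x\<in>F. (norm (l2_apply f x))\<^sup>2)) \<le> \<epsilon>\<^sup>2"
    by (force simp: eventually_finite_subsets_at_top)
  obtain \<gamma> where \<gamma>: "\<gamma> \<in> carrier G" "\<forall>x\<in>F. norm (W x - V (\<phi> \<gamma> x)) < \<epsilon>"
    using V W F(1) \<open>\<epsilon> > 0\<close> unfolding pseudo_ergodic_def by (metis image_mono order.trans subset_UNIV)
  have "(norm (mult_op (V \<circ> \<phi> \<gamma>) f - mult_op W f))\<^sup>2 \<le> \<epsilon>\<^sup>2 * (norm f)\<^sup>2 + \<epsilon>\<^sup>2"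
    by (rule mult_op_close[OF W _ B F(1) _ F(2)])
      (use V \<gamma>(2) in \<open>auto simp: pseudo_ergodic_def less_imp_le\<close>)
  also have "\<dots> \<le> (\<epsilon> * (norm f + 1))\<^sup>2"
    using \<open>\<epsilon> > 0\<close> by (simp add: power_mult_distrib power2_sum distrib_left)
  finally have "norm (mult_op (V \<circ> \<phi> \<gamma>) f - mult_op W f) \<le> \<epsilon> * (norm f + 1)"
    by (rule power2_le_imp_le) (use \<open>\<epsilon> > 0\<close> in simp)
  with \<gamma>(1) show ?thesis ..
qed

text \<open>Each term of a sequence witnessing \<open>z \<in> \<sigma>\<^sub>l\<^sub>o\<^sub>c(H\<^sub>0 + W)\<close> is translated by its own \<open>\<gamma>\<close>. The
  translated sequence has the same bound on the variances, and the error of replacing \<open>W\<close> by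
  \<open>V \<circ> \<gamma>\<close> on the \<open>n\<close>-th term is of order \<open>1 / n\<close>.\<close>

lemma localized_spectrum_subset:
  fixes G :: "('g, 'm) monoid_scheme"
    and \<phi> :: "'g \<Rightarrow> 'x::metric_space \<Rightarrow> 'x"
    and M :: "('k \<Rightarrow>\<^sub>L 'k::complex_hilbert_space) set"
  assumes action: "group_action G UNIV \<phi>"
    and iso: "\<And>\<gamma> x y. \<gamma> \<in> carrier G \<Longrightarrow> dist (\<phi> \<gamma> x) (\<phi> \<gamma> y) = dist x y"
    and H0: "bounded_clinear H0"
    and inv: "\<And>\<gamma> f. \<gamma> \<in> carrier G \<Longrightarrow> H0 (translate_op G \<phi> \<gamma> f) = translate_op G \<phi> \<gamma> (H0 f)"
    and M: "bounded M" and V: "pseudo_ergodic G \<phi> M V" and W: "range W \<subseteq> M"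
  shows "localized_spectrum (\<lambda>f. tensor_id H0 f + mult_op W f)
    \<subseteq> localized_spectrum (\<lambda>f. tensor_id H0 f + mult_op V f)"
proof
  fix z assume "z \<in> localized_spectrum (\<lambda>f. tensor_id H0 f + mult_op W f)"
  then obtain f C where f: "\<And>n. norm (f n) = 1" "\<And>n. variance (f n) \<le> ennreal C"
    and lim: "(\<lambda>n. norm (tensor_id H0 (f n) + mult_op W (f n) - z *\<^sub>C f n)) \<longlonglongrightarrow> 0"
    by (auto simp: localized_spectrum_def)
  have "\<exists>\<gamma>\<in>carrier G. norm (mult_op (V \<circ> \<phi> \<gamma>) (f n) - mult_op W (f n)) \<le> inverse (Suc n) * 2" for n
    using pseudo_ergodic_approximates[OF V W M, of "inverse (Suc n)" "f n"] f(1)[of n] by simp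
  then obtain \<gamma> where \<gamma>: "\<And>n. \<gamma> n \<in> carrier G"
    and close: "\<And>n. norm (mult_op (V \<circ> \<phi> (\<gamma> n)) (f n) - mult_op W (f n)) \<le> inverse (Suc n) * 2"
    by metis
  define g where "g n = translate_op G \<phi> (\<gamma> n) (f n)" for n
  have bV: "bounded (range V)"
    using V M by (auto simp: pseudo_ergodic_def intro: bounded_subset)
  have le: "norm (tensor_id H0 (g n) + mult_op V (g n) - z *\<^sub>C g n)
      \<le> norm (tensor_id H0 (f n) + mult_op W (f n) - z *\<^sub>C f n) + inverse (Suc n) * 2" for n
  proof -
    let ?U = "translate_op G \<phi> (\<gamma> n)"
    have "tensor_id H0 (g n) = ?U (tensor_id H0 (f n))"
      unfolding g_def by (intro tensor_id_translate_op action \<gamma> H0 inv)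
    moreover have "mult_op V (g n) = ?U (mult_op (V \<circ> \<phi> (\<gamma> n)) (f n))"
      unfolding g_def by (rule mult_op_translate_op[OF action \<gamma> bV])
    moreover have "z *\<^sub>C g n = ?U (z *\<^sub>C f n)"
      unfolding g_def by (rule translate_op_scaleC[OF action \<gamma>, symmetric])
    ultimately have "tensor_id H0 (g n) + mult_op V (g n) - z *\<^sub>C g n
        = ?U (tensor_id H0 (f n) + mult_op (V \<circ> \<phi> (\<gamma> n)) (f n) - z *\<^sub>C f n)"
      by (simp add: translate_op_add[OF action \<gamma>] translate_op_diff[OF action \<gamma>])
    then have "norm (tensor_id H0 (g n) + mult_op V (g n) - z *\<^sub>C g n)
        = norm ((tensor_id H0 (f n) + mult_op W (f n) - z *\<^sub>C f n)
          + (mult_op (V \<circ> \<phi> (\<gamma> n)) (f n) - mult_op W (f n)))"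
      by (simp add: norm_translate_op[OF action \<gamma>] algebra_simps)
    also have "\<dots> \<le> norm (tensor_id H0 (f n) + mult_op W (f n) - z *\<^sub>C f n) + inverse (Suc n) * 2"
      by (rule norm_triangle_le[OF add_left_mono[OF close]])
    finally show ?thesis .
  qed
  have bound_lim: "(\<lambda>n. norm (tensor_id H0 (f n) + mult_op W (f n) - z *\<^sub>C f n) + inverse (Suc n) * 2)
      \<longlonglongrightarrow> 0"
    using tendsto_add[OF lim tendsto_mult_left_zero[OF LIMSEQ_inverse_real_of_nat, of 2]] by simp
  have "(\<lambda>n. norm (tensor_id H0 (g n) + mult_op V (g n) - z *\<^sub>C g n)) \<longlonglongrightarrow> 0"
    by (rule Lim_null_comparison[OF always_eventually bound_lim])
      (simp only: real_norm_def abs_norm_cancel le simp_thms)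
  moreover have "norm (g n) = 1" for n
    using f(1) by (simp add: g_def norm_translate_op[OF action \<gamma>])
  moreover have "variance (g n) \<le> ennreal C" for n
    unfolding g_def using variance_translate_op_le[OF action \<gamma> iso[OF \<gamma>]] f(2) order.trans by blast
  ultimately show "z \<in> localized_spectrum (\<lambda>f. tensor_id H0 f + mult_op V f)"
    unfolding localized_spectrum_def by blast
qed

lemma eigenvalue_in_localized_spectrum:
  assumes "norm f = 1" "A f = z *\<^sub>C f" "variance f < \<infinity>"
  shows "z \<in> localized_spectrum A"
proof -
  obtain C where "variance f = ennreal C"
    using assms(3) by (cases "variance f") auto
  then show ?thesis
    unfolding localized_spectrum_def using assms(1,2)
    by (intro CollectI exI[of _ "\<lambda>_. f"]) auto
qed

theorem theorem6:
  fixes G :: "('g, 'm) monoid_scheme"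
    and \<phi> :: "'g \<Rightarrow> 'x::metric_space \<Rightarrow> 'x"
    and H0 :: "('x, complex) l2 \<Rightarrow> ('x, complex) l2"
    and M :: "('k \<Rightarrow>\<^sub>L 'k::complex_hilbert_space) set"
    and V W :: "'x \<Rightarrow> 'k \<Rightarrow>\<^sub>L 'k"
    and H K :: "('x, 'k) l2 \<Rightarrow> ('x, 'k) l2"
  assumes countable_X: "countable (UNIV :: 'x set)"
    and finite_balls: "\<And>(y::'x) r. finite {x. dist x y \<le> r}"
    and action: "group_action G UNIV \<phi>"
    and isometries: "\<And>\<gamma> x y. \<gamma> \<in> carrier G \<Longrightarrow> dist (\<phi> \<gamma> x) (\<phi> \<gamma> y) = dist x y"
    and H0_bounded: "bounded_clinear H0"
    and H0_invariant: "\<And>\<gamma> f. \<gamma> \<in> carrier G \<Longrightarrow>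
        H0 (translate_op G \<phi> \<gamma> f) = translate_op G \<phi> \<gamma> (H0 f)"
    and M_clinear: "\<And>T. T \<in> M \<Longrightarrow> bounded_clinear (blinfun_apply T)"
    and M_closed: "closed M"
    and M_bounded: "bounded M"
    and V: "pseudo_ergodic G \<phi> M V"
    and W: "range W \<subseteq> M"
    and H_def: "H = (\<lambda>f. tensor_id H0 f + mult_op V f)"
    and K_def: "K = (\<lambda>f. tensor_id H0 f + mult_op W f)"
  shows "localized_spectrum K \<subseteq> localized_spectrum H \<and>
    (\<forall>z f. norm f = 1 \<and> K f = z *\<^sub>C f \<and> variance f < \<infinity> \<longrightarrow> z \<in> localized_spectrum H) \<and>
    (pseudo_ergodic G \<phi> M W \<longrightarrow> localized_spectrum H = localized_spectrum K)"
proof -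
  have sub: "localized_spectrum K \<subseteq> localized_spectrum H"
    unfolding H_def K_def
    by (rule localized_spectrum_subset[OF action isometries H0_bounded H0_invariant M_bounded V W])
  moreover have "localized_spectrum H \<subseteq> localized_spectrum K" if "pseudo_ergodic G \<phi> M W"
    unfolding H_def K_def
    by (rule localized_spectrum_subset[OF action isometries H0_bounded H0_invariant M_bounded that])
      (use V in \<open>simp_all add: pseudo_ergodic_def\<close>)
  ultimately show ?thesis
    using eigenvalue_in_localized_spectrum[of _ K] by blast
qed

end
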